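(* Let $G$ be a finite group, let $I$ and $\Lambda$ be finite index sets, and let $P=(p_{\lambda i})$ be a $\Lambda\times I$ matrix with entries in $G$. Suppose that $\mathcal{M}[G;I,\Lambda;P]$ is not commutative. Then $\mathcal{G}(\mathcal{M}[G;I,\Lambda;P])$ contains no left paths.
   Context: The Rees matrix semigroup $\mathcal{M}[G;I,\Lambda;P]$ over the group $G$ is the set $I\times G\times\Lambda$ with multiplication $(i,x,\lambda)(j,y,\mu)=(i,xp_{\lambda j}y,\mu)$. The center of a semigroup $S$ is $Z(S)=\{x\in S: xy=yx\text{ for all }y\in S\}$. For a finite non-commutative semigroup $S$, the commuting graph $\mathcal{G}(S)$ is the simple graph with vertex set $S\setminus Z(S)$ in which two distinct vertices $x,y$ are adjacent if and only if $xy=yx$. A left path in $\mathcal{G}(S)$ is a path $x_1,\ldots,x_n$ in $\mathcal{G}(S)$ such that $x_1\neq x_n$ and $x_1x_i=x_nx_i$ for all $i\in\{1,\ldots,n\}$. Here a path is a sequence of vertices, pairwise distinct except possibly for the first and last ones, in which consecutive vertices are joined by edges and these edges are pairwise distinct. *)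

theory Defs
  imports "HOL-Algebra.Group" "Graph_Theory.Graph_Theory"
begin

section \<open>Semigroups as objects\<close>

text \<open>A record of its own, because the record underlying monoids and groups in the
  algebra library carries an identity element, which a semigroup need not have.\<close>

record 'a sgrp = "'a partial_object" +
  smult :: "'a \<Rightarrow> 'a \<Rightarrow> 'a" (infixl \<open>\<odot>\<index>\<close> 70)

locale sgrp =
  fixes S (structure)
  assumes smult_closed: "\<lbrakk>x \<in> carrier S; y \<in> carrier S\<rbrakk> \<Longrightarrow> x \<odot> y \<in> carrier S"
    and smult_assoc: "\<lbrakk>x \<in> carrier S; y \<in> carrier S; z \<in> carrier S\<rbrakk>
      \<Longrightarrow> (x \<odot> y) \<odot> z = x \<odot> (y \<odot> z)"

definition sgrp_commutative :: "('a, 'm) sgrp_scheme \<Rightarrow> bool" where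
  "sgrp_commutative S \<longleftrightarrow>
     (\<forall>x\<in>carrier S. \<forall>y\<in>carrier S. x \<odot>\<^bsub>S\<^esub> y = y \<odot>\<^bsub>S\<^esub> x)"

definition sgrp_center :: "('a, 'm) sgrp_scheme \<Rightarrow> 'a set" where
  "sgrp_center S = {x \<in> carrier S. \<forall>y\<in>carrier S. x \<odot>\<^bsub>S\<^esub> y = y \<odot>\<^bsub>S\<^esub> x}"

section \<open>Rees matrix semigroups over groups\<close>

text \<open>The entry \<open>p\<^sub>\<lambda>\<^sub>i\<close> of the sandwich matrix is \<open>P \<lambda> i\<close>; only its values for
  \<open>\<lambda> \<in> \<Lambda>\<close> and \<open>i \<in> I\<close> matter.\<close>

definition rees_matrix_sgrp ::
  "('g, 'm) monoid_scheme \<Rightarrow> 'i set \<Rightarrow> 'l set \<Rightarrow> ('l \<Rightarrow> 'i \<Rightarrow> 'g) \<Rightarrow> ('i \<times> 'g \<times> 'l) sgrp"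
where
  "rees_matrix_sgrp G I \<Lambda> P =
    \<lparr> carrier = I \<times> carrier G \<times> \<Lambda>,
      smult = (\<lambda>(i, x, \<kappa>) (j, y, \<mu>). (i, x \<otimes>\<^bsub>G\<^esub> P \<kappa> j \<otimes>\<^bsub>G\<^esub> y, \<mu>)) \<rparr>"

lemma rees_matrix_sgrp_is_sgrp:
  assumes "group G" and "\<And>l i. \<lbrakk>l \<in> \<Lambda>; i \<in> I\<rbrakk> \<Longrightarrow> P l i \<in> carrier G"
  shows "sgrp (rees_matrix_sgrp G I \<Lambda> P)"
proof -
  interpret group G by fact
  show ?thesis
    by unfold_locales (auto simp: rees_matrix_sgrp_def assms(2) m_assoc)
qed

section \<open>Commuting graphs\<close>

text \<open>Following the graph library, a simple graph is a loop-free symmetric digraph whose arcs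
  are pairs of vertices; the undirected edge \<open>{x, y}\<close> is represented by the two arcs
  \<open>(x, y)\<close> and \<open>(y, x)\<close>.\<close>

definition commuting_graph :: "('a, 'm) sgrp_scheme \<Rightarrow> 'a pair_pre_digraph" where
  "commuting_graph S =
    \<lparr> pverts = carrier S - sgrp_center S,
      parcs = {(x, y). x \<in> carrier S - sgrp_center S \<and> y \<in> carrier S - sgrp_center S
                 \<and> x \<noteq> y \<and> x \<odot>\<^bsub>S\<^esub> y = y \<odot>\<^bsub>S\<^esub> x} \<rparr>"

lemma commuting_graph_is_graph:
  assumes "finite (carrier S)"
  shows "pair_graph (commuting_graph S)"
proof
  have "parcs (commuting_graph S) \<subseteq> carrier S \<times> carrier S"
    by (auto simp: commuting_graph_def)
  then show "finite (parcs (commuting_graph S))"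
    using assms by (meson finite_SigmaI finite_subset)
qed (use assms in \<open>auto simp: commuting_graph_def symmetric_def arcs_ends_def
       arc_to_ends_def sym_def\<close>)

section \<open>Paths and left paths\<close>

text \<open>The library's \<open>vpath\<close> requires all vertices to be distinct, whereas here the first and
  the last vertex of a path may coincide. The edges traversed are compared as undirected edges,
  so that \<open>x, y, x\<close> is not a path.\<close>

definition graph_path :: "'a pair_pre_digraph \<Rightarrow> 'a list \<Rightarrow> bool" where
  "graph_path H xs \<longleftrightarrow>
     vwalk xs (with_proj H)
     \<and> (\<forall>j<length xs. \<forall>i<j. xs ! i = xs ! j \<longrightarrow> i = 0 \<and> j = length xs - 1)
     \<and> distinct (map (\<lambda>(x, y). {x, y}) (vwalk_arcs xs))"

definition left_path :: "('a, 'm) sgrp_scheme \<Rightarrow> 'a list \<Rightarrow> bool" where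
  "left_path S xs \<longleftrightarrow>
     graph_path (commuting_graph S) xs
     \<and> hd xs \<noteq> last xs
     \<and> (\<forall>x\<in>set xs. hd xs \<odot>\<^bsub>S\<^esub> x = last xs \<odot>\<^bsub>S\<^esub> x)"

end

theory Submission
  imports Defs
begin

text \<open>
  A product in a Rees matrix semigroup takes its first coordinate from the left factor and its
  last coordinate from the right factor. Two commuting elements therefore agree in both outer
  coordinates, so the commuting graph never leaves the \<open>\<H>\<close>-class
  \<open>{i} \<times> G \<times> {\<lambda>}\<close> of the vertex at which a walk starts
  (\<open>walk_outer_coords\<close>). In such a class the middle coordinate can be cancelled,
  because the sandwich matrix has its entries in a group (\<open>rees_right_cancel\<close>). The
  equation \<open>x\<^sub>1x\<^sub>1 = x\<^sub>nx\<^sub>1\<close>, which is one of the conditions on a left path,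
  thus forces \<open>x\<^sub>1 = x\<^sub>n\<close>.
\<close>

lemma rees_commute_outer_coords:
  assumes "x \<odot>\<^bsub>rees_matrix_sgrp G I \<Lambda> P\<^esub> y = y \<odot>\<^bsub>rees_matrix_sgrp G I \<Lambda> P\<^esub> x"
  shows "fst x = fst y" and "snd (snd x) = snd (snd y)"
  using assms by (cases x; cases y; simp add: rees_matrix_sgrp_def)+

lemma walk_outer_coords:
  assumes "vwalk xs (with_proj (commuting_graph (rees_matrix_sgrp G I \<Lambda> P)))"
    and "x \<in> set xs"
  shows "fst x = fst (hd xs) \<and> snd (snd x) = snd (snd (hd xs))"
  using assms
proof (induction xs rule: vwalk_induct)
  case (Base u)
  then show ?case by simp
next
  case (Cons u v es)
  have "u \<odot>\<^bsub>rees_matrix_sgrp G I \<Lambda> P\<^esub> v = v \<odot>\<^bsub>rees_matrix_sgrp G I \<Lambda> P\<^esub> u"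
    using Cons.hyps by (simp add: commuting_graph_def)
  from rees_commute_outer_coords[OF this] Cons show ?case by auto
qed

text \<open>For \<open>x = (i, a, \<lambda>)\<close> and \<open>z = (j, c, \<mu>)\<close> the product is
  \<open>(i, ap\<^sub>\<lambda>\<^sub>jc, \<mu>)\<close>, and cancelling \<open>p\<^sub>\<lambda>\<^sub>jc\<close> in
  \<open>G\<close> recovers \<open>a\<close> only once \<open>\<lambda>\<close> is known. The product does not
  determine \<open>\<lambda>\<close>: replacing it by \<open>\<kappa>\<close> can be compensated by changing
  \<open>a\<close> to \<open>ap\<^sub>\<lambda>\<^sub>jp\<^sub>\<kappa>\<^sub>j\<^sup>-\<^sup>1\<close>. Hence the hypothesis on
  the last coordinates.\<close>

lemma rees_right_cancel:
  assumes "group G" and P: "\<And>l i. \<lbrakk>l \<in> \<Lambda>; i \<in> I\<rbrakk> \<Longrightarrow> P l i \<in> carrier G"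
    and "x \<in> carrier (rees_matrix_sgrp G I \<Lambda> P)"
    and "y \<in> carrier (rees_matrix_sgrp G I \<Lambda> P)"
    and "z \<in> carrier (rees_matrix_sgrp G I \<Lambda> P)"
    and "snd (snd x) = snd (snd y)"
    and "x \<odot>\<^bsub>rees_matrix_sgrp G I \<Lambda> P\<^esub> z = y \<odot>\<^bsub>rees_matrix_sgrp G I \<Lambda> P\<^esub> z"
  shows "x = y"
proof -
  interpret group G by fact
  show ?thesis
    using assms(3-) P by (auto simp: rees_matrix_sgrp_def)
qed

theorem theorem3p10:
  fixes G :: "('g, 'm) monoid_scheme"
    and I :: "'i set"
    and \<Lambda> :: "'l set"
    and P :: "'l \<Rightarrow> 'i \<Rightarrow> 'g"
  assumes "group G" and "finite (carrier G)"
    and "finite I" and "finite \<Lambda>"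
    and "\<And>l i. \<lbrakk>l \<in> \<Lambda>; i \<in> I\<rbrakk> \<Longrightarrow> P l i \<in> carrier G"
    and "\<not> sgrp_commutative (rees_matrix_sgrp G I \<Lambda> P)"
  shows "\<not> (\<exists>xs. left_path (rees_matrix_sgrp G I \<Lambda> P) xs)"
proof
  let ?S = "rees_matrix_sgrp G I \<Lambda> P"
  assume "\<exists>xs. left_path ?S xs"
  then obtain xs where walk: "vwalk xs (with_proj (commuting_graph ?S))"
    and ends: "hd xs \<noteq> last xs"
    and eq: "\<And>x. x \<in> set xs \<Longrightarrow> hd xs \<odot>\<^bsub>?S\<^esub> x = last xs \<odot>\<^bsub>?S\<^esub> x"
    by (auto simp: left_path_def graph_path_def)
  from walk have "xs \<noteq> []" and "set xs \<subseteq> carrier ?S"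
    by (auto simp: vwalk_def commuting_graph_def)
  then have hd: "hd xs \<in> set xs" "hd xs \<in> carrier ?S"
    and last: "last xs \<in> set xs" "last xs \<in> carrier ?S"
    by auto
  from walk_outer_coords[OF walk last(1)] have "snd (snd (hd xs)) = snd (snd (last xs))"
    by simp
  with rees_right_cancel[OF assms(1,5) hd(2) last(2) hd(2)] eq[OF hd(1)] ends
  show False by blast
qed

end
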